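(* Let $d\ge 2$ and let $\tilde\lambda$ be a normalized conditional intensity that satisfies condition (P) with constants $r>0$ and $\delta>0$. Then for every $R>r$ there exists $\beta_+<\infty$ such that for all $\beta>\beta_+$ and for all Gibbs point processes $\Xi$ with distribution in $\mathcal{G}(\beta,\tilde\lambda)$, the set $Z_R(\Xi)=\bigcup_{x\in\Xi}\mathbb{B}_R(x)$ contains almost surely an infinite cluster.
   Context: Spaces. Let $d\ge2$; $|\Lambda|$ denotes the Lebesgue measure of a measurable $\Lambda\subset\mathbb{R}^d$, $\|\cdot\|$ the Euclidean norm, $\mathbb{B}_R(x)$ the open ball of radius $R$ around $x$, $\Lambda^{\mathsf c}=\mathbb{R}^d\setminus\Lambda$, and $\mathrm{dist}(\Lambda,\Lambda')=\inf_{x\in\Lambda,\,y\in\Lambda'}\|x-y\|$, with $\mathrm{dist}(x,\Lambda')=\mathrm{dist}(\{x\},\Lambda')$ (infimum over the empty set is $\infty$). $(\mathfrak{N},\mathcal{N})$ is the space of locally finite point measures on $\mathbb{R}^d$ with the $\sigma$-algebra generated by the maps $\xi\mapsto\xi(\Lambda)$, $\Lambda$ bounded Borel. A point process is a random element of $\mathfrak{N}$; all point processes are assumed simple (no multiple points), so configurations are treated as locally finite subsets of $\mathbb{R}^d$. $\mathfrak{N}_\Lambda$ is the space of configurations in $\Lambda$, and $\xi|_\Lambda$ is the restriction of $\xi$ to $\Lambda$. Gibbs measures. A potential is a measurable function $\Phi:\mathfrak{N}\to\mathbb{R}\cup\{\infty\}$ (with $e^{-\infty}=0$). For bounded measurable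 $\Lambda$, a boundary condition $\omega\in\mathfrak{N}_{\Lambda^{\mathsf c}}$ and $\xi\in\mathfrak{N}_\Lambda$ put $$u_{\Lambda,\omega}(\xi)=\exp\Big(-\sum_{\xi'\subset\xi,\ \xi'\ne\emptyset,\ \omega'\subset\omega}\Phi(\xi'\cup\omega')\Big),$$ $$\mu_{\Lambda,\omega}(A)=\frac{1}{c_{\Lambda,\omega}}\Big(\mathbf{1}\{\omega\in A\}+\sum_{k\ge1}\frac1{k!}\int_\Lambda\cdots\int_\Lambda\mathbf{1}\{\{x_1,\dots,x_k\}\cup\omega\in A\}\,u_{\Lambda,\omega}(\{x_1,\dots,x_k\})\,dx_1\cdots dx_k\Big),$$ where $c_{\Lambda,\omega}=1+\sum_{k\ge1}\frac1{k!}\int_\Lambda\cdots\int_\Lambda u_{\Lambda,\omega}(\{x_1,\dots,x_k\})\,dx_1\cdots dx_k$. It is a standing assumption that $\Phi$ is such that $\mu_{\Lambda,\omega}$ is well defined for all bounded measurable $\Lambda$ and all $\omega\in\mathfrak{N}_{\Lambda^{\mathsf c}}$. A probability measure $\mu$ on $\mathfrak{N}$ is a Gibbs measure for $\Phi$ if $\mu(A)=\int_{\mathfrak{N}}\mu_{\Lambda,\xi|_{\Lambda^{\mathsf c}}}(A)\,\mu(d\xi)$ for all $A\in\mathcal{N}$ and all bounded measurable $\Lambda\subset\mathbb{R}^d$. A Gibbs point process is a point process whose distribution is a Gibbs measure. Conditional intensity and activity. It is assumed that $\Phi(\{x\})=\Phi(\{0\})$ for all $x\in\mathbb{R}^d$.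 The activity is $\beta=\exp(-\Phi(\{0\}))$. The conditional intensity is $\lambda(x\mid\xi)=\exp\big(-\sum_{\xi'\subset\xi}\Phi(\{x\}\cup\xi')\big)$, and the normalized conditional intensity is $$\tilde\lambda(x\mid\xi)=\frac{\lambda(x\mid\xi)}{\beta}=\exp\Big(-\sum_{\xi'\subset\xi,\ \xi'\ne\emptyset}\Phi(\{x\}\cup\xi')\Big).$$ $\mathcal{G}(\beta,\tilde\lambda)$ denotes the set of Gibbs measures corresponding to the conditional intensity $\beta\tilde\lambda$ (so varying $\beta$ with $\tilde\lambda$ fixed means varying only the one-point value of the potential). Condition (P). A Gibbs point process $\Xi\sim\mu\in\mathcal{G}(\beta,\tilde\lambda)$ satisfies condition (P) with constants $r,\delta>0$ if $\tilde\lambda(x\mid\xi)\ge\delta$ for all $x\in\mathbb{R}^d$ and for $\mu$-a.e. $\xi\in\mathfrak{N}$ with $\mathrm{dist}(x,\xi)\ge r$. The function $\tilde\lambda$ itself satisfies condition (P) with constants $r,\delta$ if, for all $\beta>0$, all Gibbs processes with distribution in $\mathcal{G}(\beta,\tilde\lambda)$ satisfy condition (P) with constants $r,\delta$. Clusters. A cluster of $Z_R(\Xi)=\bigcup_{x\in\Xi}\mathbb{B}_R(x)$ is a connected component of this set; infinite means unbounded (equivalently, containing infinitely many points of $\Xi$). *)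

theory Defs
  imports "HOL-Probability.Probability"
begin

section \<open>Configurations\<close>

text \<open>Point processes are simple, so a configuration is a locally finite set of points.\<close>

definition configs :: "'a::euclidean_space set set" where
  "configs = {\<xi>. \<forall>B. bounded B \<longrightarrow> finite (\<xi> \<inter> B)}"

definition bounded_borel :: "'a::euclidean_space set \<Rightarrow> bool" where
  "bounded_borel L \<longleftrightarrow> bounded L \<and> L \<in> sets borel"

definition config_algebra :: "'a::euclidean_space set measure" where
  "config_algebra = sigma configs
     {(\<lambda>\<xi>. card (\<xi> \<inter> L)) -` S \<inter> configs | L S. bounded_borel L}"

text \<open>The library's \<open>infdist\<close> and \<open>setdist\<close> vanish on the empty set; here the infimum over
  the empty set has to be infinite.\<close>

definition point_dist :: "'a::euclidean_space \<Rightarrow> 'a set \<Rightarrow> ereal" where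
  "point_dist x \<xi> = (INF y\<in>\<xi>. ereal (dist x y))"


section \<open>Gibbs measures\<close>

text \<open>\<open>exp_neg s\<close> is \<open>exp (- s)\<close> with \<open>exp (- \<infinity>) = 0\<close>. It is only meaningful for
  \<open>s \<noteq> - \<infinity>\<close>, which \<open>well_defined\<close> below guarantees wherever it is used.\<close>

definition exp_neg :: "ereal \<Rightarrow> real" where
  "exp_neg s = (if s = \<infinity> then 0 else exp (- real_of_ereal s))"

text \<open>The sums over sub-configurations may be infinite. They are unconditional sums in the
  extended reals, i.e. limits along the net of finite sets of summands.\<close>

definition energy_index :: "'a set \<Rightarrow> 'a set \<Rightarrow> ('a set \<times> 'a set) set" where
  "energy_index \<xi> \<omega> = {(\<xi>', \<omega>'). \<xi>' \<subseteq> \<xi> \<and> \<xi>' \<noteq> {} \<and> \<omega>' \<subseteq> \<omega>}"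

definition energy :: "('a set \<Rightarrow> ereal) \<Rightarrow> 'a set \<Rightarrow> 'a set \<Rightarrow> ereal" where
  "energy \<Phi> \<omega> \<xi> = (\<Sum>\<^sub>\<infinity>(\<xi>', \<omega>')\<in>energy_index \<xi> \<omega>. \<Phi> (\<xi>' \<union> \<omega>'))"

definition gibbs_weight :: "('a set \<Rightarrow> ereal) \<Rightarrow> 'a set \<Rightarrow> 'a set \<Rightarrow> real" where
  "gibbs_weight \<Phi> \<omega> \<xi> = exp_neg (energy \<Phi> \<omega> \<xi>)"

text \<open>Lebesgue measure on the \<open>k\<close>-fold power of \<open>L\<close>; a tuple is a function on \<open>{..<k}\<close>, and
  \<open>x ` {..<k}\<close> is the configuration of its entries.\<close>

definition tuples :: "'a::euclidean_space set \<Rightarrow> nat \<Rightarrow> (nat \<Rightarrow> 'a) measure" where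
  "tuples L k = (\<Pi>\<^sub>M i\<in>{..<k}. restrict_space lborel L)"

definition gibbs_norm ::
  "('a::euclidean_space set \<Rightarrow> ereal) \<Rightarrow> 'a set \<Rightarrow> 'a set \<Rightarrow> ennreal" where
  "gibbs_norm \<Phi> L \<omega> = 1 + (\<Sum>k. inverse (fact (Suc k)) *
     (\<integral>\<^sup>+x. ennreal (gibbs_weight \<Phi> \<omega> (x ` {..<Suc k})) \<partial>tuples L (Suc k)))"

definition gibbs_spec ::
  "('a::euclidean_space set \<Rightarrow> ereal) \<Rightarrow> 'a set \<Rightarrow> 'a set \<Rightarrow> 'a set set \<Rightarrow> ennreal" where
  "gibbs_spec \<Phi> L \<omega> A =
     (indicator A \<omega> + (\<Sum>k. inverse (fact (Suc k)) *
        (\<integral>\<^sup>+x. indicator A (x ` {..<Suc k} \<union> \<omega>) *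
               ennreal (gibbs_weight \<Phi> \<omega> (x ` {..<Suc k})) \<partial>tuples L (Suc k))))
     / gibbs_norm \<Phi> L \<omega>"

text \<open>\<open>well_defined\<close> spells out the standing assumption that \<open>gibbs_spec \<Phi> L \<omega>\<close> is a
  well-defined probability measure for every bounded Borel \<open>L\<close> and every boundary condition
  \<open>\<omega>\<close> outside \<open>L\<close>: the energies exist in \<open>(- \<infinity>, \<infinity>]\<close>, the integrals over the tuples and
  over the boundary condition are integrals of measurable functions, and the normalizing
  constant is finite. Measurability of the weight has to be required because the sum runs over
  all, possibly uncountably many, sub-configurations of \<open>\<omega>\<close>.\<close>

definition well_defined :: "('a::euclidean_space set \<Rightarrow> ereal) \<Rightarrow> bool" where
  "well_defined \<Phi> \<longleftrightarrow> (\<forall>L. bounded_borel L \<longrightarrow>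
     (\<forall>\<omega>\<in>configs. \<omega> \<inter> L = {} \<longrightarrow>
        (\<forall>\<xi>\<in>configs. \<xi> \<subseteq> L \<longrightarrow>
           (\<lambda>(\<xi>', \<omega>'). \<Phi> (\<xi>' \<union> \<omega>')) summable_on energy_index \<xi> \<omega> \<and> energy \<Phi> \<omega> \<xi> \<noteq> - \<infinity>) \<and>
        gibbs_norm \<Phi> L \<omega> < \<infinity>) \<and>
     (\<forall>k. (\<lambda>(x, \<xi>). gibbs_weight \<Phi> (\<xi> - L) (x ` {..<k}))
            \<in> borel_measurable (tuples L k \<Otimes>\<^sub>M config_algebra)))"

definition potential :: "('a::euclidean_space set \<Rightarrow> ereal) \<Rightarrow> bool" where
  "potential \<Phi> \<longleftrightarrow> \<Phi> \<in> borel_measurable config_algebra \<and> (\<forall>\<xi>\<in>configs. \<Phi> \<xi> \<noteq> - \<infinity>) \<and>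
     (\<forall>x. \<Phi> {x} = \<Phi> {0}) \<and> well_defined \<Phi>"

definition gibbs_measure ::
  "('a::euclidean_space set \<Rightarrow> ereal) \<Rightarrow> 'a set measure \<Rightarrow> bool" where
  "gibbs_measure \<Phi> \<mu> \<longleftrightarrow> prob_space \<mu> \<and> sets \<mu> = sets config_algebra \<and>
     (\<forall>L. bounded_borel L \<longrightarrow> (\<forall>A\<in>sets config_algebra.
        emeasure \<mu> A = (\<integral>\<^sup>+\<xi>. gibbs_spec \<Phi> L (\<xi> - L) A \<partial>\<mu>)))"


section \<open>Conditional intensity and activity\<close>

definition activity :: "('a::euclidean_space set \<Rightarrow> ereal) \<Rightarrow> real" where
  "activity \<Phi> = exp_neg (\<Phi> {0})"

definition cond_intensity :: "('a set \<Rightarrow> ereal) \<Rightarrow> 'a \<Rightarrow> 'a set \<Rightarrow> real" where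
  "cond_intensity \<Phi> x \<xi> = exp_neg (\<Sum>\<^sub>\<infinity>\<xi>'\<in>Pow \<xi>. \<Phi> ({x} \<union> \<xi>'))"

text \<open>Conditional intensities are only compared at points \<open>x\<close> outside \<open>\<xi>\<close>: with configurations
  as sets, adding \<open>x \<in> \<xi>\<close> would not produce a new configuration.\<close>

definition has_cond_intensity ::
  "('a::euclidean_space set \<Rightarrow> ereal) \<Rightarrow> ('a \<Rightarrow> 'a set \<Rightarrow> real) \<Rightarrow> bool" where
  "has_cond_intensity \<Phi> f \<longleftrightarrow> (\<forall>\<xi>\<in>configs. \<forall>x. x \<notin> \<xi> \<longrightarrow> cond_intensity \<Phi> x \<xi> = f x \<xi>)"

definition normalized_cond_intensity ::
  "('a::euclidean_space \<Rightarrow> 'a set \<Rightarrow> real) \<Rightarrow> bool" where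
  "normalized_cond_intensity lt \<longleftrightarrow> (\<exists>\<Phi>. potential \<Phi> \<and> activity \<Phi> > 0 \<and>
     has_cond_intensity \<Phi> (\<lambda>x \<xi>. activity \<Phi> * lt x \<xi>))"

text \<open>The Gibbs measures with activity \<open>\<beta>\<close> and conditional intensity \<open>\<beta> * lt\<close>.\<close>

definition gibbs_measures ::
  "real \<Rightarrow> ('a::euclidean_space \<Rightarrow> 'a set \<Rightarrow> real) \<Rightarrow> 'a set measure set" where
  "gibbs_measures \<beta> lt = {\<mu>. \<exists>\<Phi>. potential \<Phi> \<and> activity \<Phi> = \<beta> \<and>
     has_cond_intensity \<Phi> (\<lambda>x \<xi>. \<beta> * lt x \<xi>) \<and> gibbs_measure \<Phi> \<mu>}"


text \<open>A Gibbs point process enters only through its distribution: an almost sure property of the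
  distribution is an almost sure property of every random element with that distribution. Stating
  results for distributions avoids tying constants to the type of a sample space.\<close>

lemma AE_point_process:
  assumes "X \<in> measurable M config_algebra"
    and "distr M config_algebra X = \<mu>"
    and "AE \<xi> in \<mu>. P \<xi>"
  shows "AE w in M. P (X w)"
  using AE_distrD[OF assms(1)] assms(2,3) by blast


section \<open>Condition (P) and clusters\<close>

definition measure_cond_P ::
  "real \<Rightarrow> real \<Rightarrow> ('a::euclidean_space \<Rightarrow> 'a set \<Rightarrow> real) \<Rightarrow> 'a set measure \<Rightarrow> bool" where
  "measure_cond_P r \<delta> lt \<mu> \<longleftrightarrow>
     (\<forall>x. AE \<xi> in \<mu>. point_dist x \<xi> \<ge> ereal r \<longrightarrow> lt x \<xi> \<ge> \<delta>)"

definition cond_P ::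
  "real \<Rightarrow> real \<Rightarrow> ('a::euclidean_space \<Rightarrow> 'a set \<Rightarrow> real) \<Rightarrow> bool" where
  "cond_P r \<delta> lt \<longleftrightarrow> (\<forall>\<beta>>0. \<forall>\<mu>\<in>gibbs_measures \<beta> lt. measure_cond_P r \<delta> lt \<mu>)"

definition Z :: "real \<Rightarrow> 'a::euclidean_space set \<Rightarrow> 'a set" where
  "Z R \<xi> = (\<Union>x\<in>\<xi>. ball x R)"

definition has_infinite_cluster :: "'a::euclidean_space set \<Rightarrow> bool" where
  "has_infinite_cluster S \<longleftrightarrow> (\<exists>C\<in>components S. \<not> bounded C)"

end

theory Submission
  imports Defs "HOL-Library.Transitive_Closure_Table"
begin

text \<open>A Peierls argument. Put \<open>h = (R - r) / 2\<close> and \<open>\<rho> = r + h\<close>. Comparing, in the Gibbs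
  specification of \<open>ball x \<rho>\<close>, the empty configuration with the configurations of one point in
  \<open>ball x h\<close>, condition (P) shows that \<open>ball x \<rho>\<close> is empty with probability at most
  \<open>\<epsilon> = 1 / (\<beta> * \<delta> * |ball x h|)\<close>, even given what happens outside \<open>ball x \<rho>\<close>; so \<open>k\<close>
  disjoint balls are all empty with probability at most \<open>\<epsilon> ^ k\<close>.

  If all clusters are bounded, then every large ball is surrounded by a compact connected set that
  avoids \<open>Z R \<xi>\<close>, since Euclidean space is unicoherent. A maximal separated subset of this set,
  rounded to a lattice with error at most \<open>h\<close>, contains a lattice path of \<open>k\<close> steps
  whose vertices have disjoint empty \<open>\<rho>\<close>-balls, with \<open>k\<close> as large as we like and a starting
  point determined by \<open>k\<close>. For given \<open>k\<close> there are at most \<open>M ^ k\<close> such paths, so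
  for \<open>M * \<epsilon> \<le> 1 / 2\<close> the Borel-Cantelli lemma excludes this almost surely.\<close>

section \<open>Empty balls in Gibbs processes\<close>

lemma space_config_algebra [simp]: "space config_algebra = configs"
  unfolding config_algebra_def by (rule space_measure_of) auto

lemma sets_config_algebra:
  "sets config_algebra = sigma_sets configs
     {(\<lambda>\<xi>. card (\<xi> \<inter> L)) -` S \<inter> configs | L S. bounded_borel L}"
  unfolding config_algebra_def by (rule sets_measure_of) auto

lemma configs_subset: "\<xi> \<in> configs \<Longrightarrow> \<eta> \<subseteq> \<xi> \<Longrightarrow> \<eta> \<in> configs"
  unfolding configs_def by (auto intro: finite_subset[of "\<eta> \<inter> B" "\<xi> \<inter> B" for B])

lemma insert_configs: "\<xi> \<in> configs \<Longrightarrow> insert x \<xi> \<in> configs"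
  unfolding configs_def by (auto simp: Int_insert_left)

lemma count_preimage_sets:
  "bounded_borel L \<Longrightarrow> (\<lambda>\<xi>. card (\<xi> \<inter> L)) -` S \<inter> configs \<in> sets config_algebra"
  unfolding sets_config_algebra by (rule sigma_sets.Basic) auto

lemma measurable_remove:
  assumes "L \<in> sets borel"
  shows "(\<lambda>\<xi>. \<xi> - L) \<in> config_algebra \<rightarrow>\<^sub>M config_algebra"
proof (rule measurable_sigma_sets[OF sets_config_algebra])
  show "(\<lambda>\<xi>. \<xi> - L) \<in> space config_algebra \<rightarrow> configs"
    by (auto intro: configs_subset)
  fix Y :: "'a set set"
  assume "Y \<in> {(\<lambda>\<xi>. card (\<xi> \<inter> L)) -` S \<inter> configs | L S. bounded_borel L}"
  then obtain K S where Y: "Y = (\<lambda>\<xi>. card (\<xi> \<inter> K)) -` S \<inter> configs" and K: "bounded_borel K"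
    by blast
  have "bounded_borel (K - L)"
    using K assms by (auto simp: bounded_borel_def intro: bounded_subset)
  moreover have "(\<lambda>\<xi>. \<xi> - L) -` Y \<inter> space config_algebra
      = (\<lambda>\<xi>. card (\<xi> \<inter> (K - L))) -` S \<inter> configs"
  proof -
    have "(\<xi> - L) \<inter> K = \<xi> \<inter> (K - L)" for \<xi> :: "'a set" by blast
    then show ?thesis by (auto simp: Y intro: configs_subset)
  qed
  ultimately show "(\<lambda>\<xi>. \<xi> - L) -` Y \<inter> space config_algebra \<in> sets config_algebra"
    by (simp add: count_preimage_sets)
qed auto

lemma void_event_sets:
  assumes "bounded_borel L"
  shows "{\<xi> \<in> configs. \<xi> \<inter> L = {}} \<in> sets config_algebra"
proof -
  \<comment> \<open>\<open>card\<close> is 0 on infinite sets too; local finiteness on the bounded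
    set \<open>L\<close> makes count 0 mean emptiness.\<close>
  have "{\<xi> \<in> configs. \<xi> \<inter> L = {}} = (\<lambda>\<xi>. card (\<xi> \<inter> L)) -` {0} \<inter> configs"
    using assms by (auto simp: configs_def bounded_borel_def)
  then show ?thesis
    using count_preimage_sets[OF assms] by simp
qed

lemma bounded_borel_ball: "bounded_borel (ball x t)"
  by (simp add: bounded_borel_def)

lemma void_events_sets:
  assumes "finite I"
  shows "{\<xi> \<in> configs. \<forall>x\<in>I. \<xi> \<inter> ball x t = {}} \<in> sets config_algebra"
proof -
  have "{\<xi> \<in> space config_algebra. \<xi> \<inter> ball x t = {}} \<in> sets config_algebra" for x :: 'a
    unfolding space_config_algebra by (intro void_event_sets bounded_borel_ball)
  from sets.sets_Collect_finite_All[OF this assms] show ?thesis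
    by (simp only: space_config_algebra)
qed

section \<open>Tuples of points and the Gibbs specification\<close>

lemma sigma_finite_tuples:
  assumes "L \<in> sets borel"
  shows "sigma_finite_measure (tuples L k)"
proof -
  interpret sigma_finite_measure "restrict_space lborel L"
    using assms by (intro sigma_finite_measure_restrict_space sigma_finite_lborel) simp
  interpret product_sigma_finite "\<lambda>_::nat. restrict_space lborel L" ..
  show ?thesis unfolding tuples_def by (rule sigma_finite) simp
qed

lemma emeasure_tuples_singleton:
  assumes "L \<in> sets borel" "B \<in> sets borel" "B \<subseteq> L"
  shows "(\<integral>\<^sup>+x. indicator B (x 0) \<partial>tuples L (Suc 0)) = emeasure lborel B"
proof -
  interpret sigma_finite_measure "restrict_space lborel L"
    using assms by (intro sigma_finite_measure_restrict_space sigma_finite_lborel) simp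
  interpret product_sigma_finite "\<lambda>_::nat. restrict_space lborel L" ..
  have "(\<integral>\<^sup>+x. indicator B (x 0) \<partial>tuples L (Suc 0)) = (\<integral>\<^sup>+x. indicator B x \<partial>restrict_space lborel L)"
    unfolding tuples_def lessThan_Suc lessThan_0
    using assms by (intro product_nn_integral_singleton) (auto simp: measurable_restrict_space1)
  also have "\<dots> = (\<integral>\<^sup>+x. indicator B x \<partial>lborel)"
    using assms(1) by (subst nn_integral_restrict_space)
      (auto intro!: nn_integral_cong simp: indicator_def subsetD[OF assms(3)])
  also have "\<dots> = emeasure lborel B" using assms by simp
  finally show ?thesis .
qed

text \<open>The only nonempty subset of \<open>{y}\<close> is \<open>{y}\<close>, so the double sum
  collapses to a sum over subsets of \<open>\<omega>\<close>. Through this identity condition (P)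
  bounds one-point weights.\<close>

lemma gibbs_weight_singleton:
  "gibbs_weight \<Phi> \<omega> {y} = cond_intensity \<Phi> y \<omega>"
proof -
  have "energy \<Phi> \<omega> {y} = (\<Sum>\<^sub>\<infinity>\<xi>'\<in>Pow \<omega>. \<Phi> ({y} \<union> \<xi>'))"
    unfolding energy_def energy_index_def
    by (rule infsum_reindex_bij_witness[where i="\<lambda>\<omega>'. ({y}, \<omega>')" and j=snd])
      (auto simp: subset_singleton_iff)
  then show ?thesis
    by (simp add: gibbs_weight_def cond_intensity_def)
qed

lemma gibbs_weight_measurable:
  assumes "potential \<Phi>" "bounded_borel L"
  shows "(\<lambda>(x, \<xi>). gibbs_weight \<Phi> (\<xi> - L) (x ` {..<k}))
            \<in> borel_measurable (tuples L k \<Otimes>\<^sub>M config_algebra)"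
  using assms unfolding potential_def well_defined_def by blast

lemma gibbs_norm_measurable:
  assumes "potential \<Phi>" "bounded_borel L"
  shows "(\<lambda>\<xi>. gibbs_norm \<Phi> L (\<xi> - L)) \<in> borel_measurable config_algebra"
proof -
  have "(\<lambda>\<xi>. \<integral>\<^sup>+x. ennreal (gibbs_weight \<Phi> (\<xi> - L) (x ` {..<Suc k})) \<partial>tuples L (Suc k))
      \<in> borel_measurable config_algebra" for k
  proof -
    interpret sigma_finite_measure "tuples L (Suc k)"
      using assms by (intro sigma_finite_tuples) (simp add: bounded_borel_def)
    have "(\<lambda>(\<xi>, x). gibbs_weight \<Phi> (\<xi> - L) (x ` {..<Suc k}))
            \<in> borel_measurable (config_algebra \<Otimes>\<^sub>M tuples L (Suc k))"
      using measurable_pair_swap[OF gibbs_weight_measurable[OF assms, of "Suc k"]]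
      by (simp add: split_beta')
    then show ?thesis by (intro borel_measurable_nn_integral) (simp add: split_beta')
  qed
  then show ?thesis unfolding gibbs_norm_def by measurable
qed

lemma gibbs_norm_finite:
  assumes "potential \<Phi>" "bounded_borel L" "\<omega> \<in> configs" "\<omega> \<inter> L = {}"
  shows "gibbs_norm \<Phi> L \<omega> < \<infinity>"
  using assms unfolding potential_def well_defined_def by blast

text \<open>Every tuple of positive length puts a point into \<open>L\<close>, so all integrals in
  the series vanish.\<close>

lemma gibbs_spec_void:
  assumes "A \<inter> {\<eta>. \<eta> \<inter> L \<noteq> {}} = {}"
  shows "gibbs_spec \<Phi> L \<omega> A = indicator A \<omega> / gibbs_norm \<Phi> L \<omega>"
proof -
  have "indicator A (x ` {..<Suc k} \<union> \<omega>) = (0::ennreal)" if "x \<in> space (tuples L (Suc k))" for x k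
  proof -
    have "x 0 \<in> L" using that by (auto simp: tuples_def space_PiM space_restrict_space)
    then have "x 0 \<in> (x ` {..<Suc k} \<union> \<omega>) \<inter> L" by auto
    then show ?thesis using assms by (auto simp: indicator_def)
  qed
  then have "(\<integral>\<^sup>+x. indicator A (x ` {..<Suc k} \<union> \<omega>) * ennreal (gibbs_weight \<Phi> \<omega> (x ` {..<Suc k}))
      \<partial>tuples L (Suc k)) = 0" for k
    by (subst nn_integral_cong[where v="\<lambda>_. 0"]) auto
  then show ?thesis unfolding gibbs_spec_def by simp
qed

lemma gibbs_spec_ge_indicator:
  "indicator A \<omega> / gibbs_norm \<Phi> L \<omega> \<le> gibbs_spec \<Phi> L \<omega> A"
  unfolding gibbs_spec_def by (intro divide_right_mono_ennreal) simp

text \<open>Index 0 of the series is the one-point term, since its tuples have length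
  \<open>Suc 0\<close>; the other terms are nonnegative.\<close>

lemma gibbs_spec_ge_single:
  "(\<integral>\<^sup>+x. indicator A (insert (x 0) \<omega>) * ennreal (gibbs_weight \<Phi> \<omega> {x 0}) \<partial>tuples L (Suc 0))
     / gibbs_norm \<Phi> L \<omega> \<le> gibbs_spec \<Phi> L \<omega> A" (is "?I / _ \<le> _")
proof -
  define h where "h k = inverse (fact (Suc k)) *
        (\<integral>\<^sup>+x. indicator A (x ` {..<Suc k} \<union> \<omega>) *
               ennreal (gibbs_weight \<Phi> \<omega> (x ` {..<Suc k})) \<partial>tuples L (Suc k))" for k
  have "?I = h 0" by (simp add: h_def lessThan_Suc)
  also have "\<dots> \<le> (\<Sum>k. h k)" using sum_le_suminf[of h "{0}"] by simp
  also have "\<dots> \<le> indicator A \<omega> + (\<Sum>k. h k)" by simp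
  finally show ?thesis
    unfolding gibbs_spec_def h_def by (rule divide_right_mono_ennreal)
qed

text \<open>A null set stays null when the configuration in a bounded set is erased, because the
  specification charges the empty configuration in that set.\<close>

lemma AE_remove:
  assumes "potential \<Phi>" "gibbs_measure \<Phi> \<mu>" "bounded_borel L" "AE \<xi> in \<mu>. P \<xi>"
  shows "AE \<xi> in \<mu>. P (\<xi> - L)"
proof -
  have sets: "sets \<mu> = sets config_algebra" using assms by (simp add: gibbs_measure_def)
  have sp: "space \<mu> = configs" using sets_eq_imp_space_eq[OF sets] by simp
  note [measurable_cong] = sets
  have L: "L \<in> sets borel" using assms by (simp add: bounded_borel_def)
  note [measurable] = measurable_remove[OF L] gibbs_norm_measurable[OF assms(1,3)]
  obtain N where N: "{\<xi> \<in> space \<mu>. \<not> P \<xi>} \<subseteq> N" "emeasure \<mu> N = 0" "N \<in> sets \<mu>"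
    using assms(4) by (rule AE_E)
  note [measurable] = N(3)
  \<comment> \<open>The DLR equation for the null set \<open>N\<close> has a zero-point term that
    evaluates \<open>N\<close> at \<open>\<xi> - L\<close>.\<close>
  have "(\<integral>\<^sup>+\<xi>. indicator N (\<xi> - L) / gibbs_norm \<Phi> L (\<xi> - L) \<partial>\<mu>)
      \<le> (\<integral>\<^sup>+\<xi>. gibbs_spec \<Phi> L (\<xi> - L) N \<partial>\<mu>)"
    by (intro nn_integral_mono gibbs_spec_ge_indicator)
  also have "\<dots> = 0" using assms(2,3) N(2,3) by (simp add: gibbs_measure_def)
  finally have "AE \<xi> in \<mu>. indicator N (\<xi> - L) / gibbs_norm \<Phi> L (\<xi> - L) = 0"
    by (subst (asm) le_zero_eq, subst (asm) nn_integral_0_iff_AE) measurable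
  then show ?thesis
  proof (rule AE_mp, intro AE_I2 impI)
    fix \<xi> assume \<xi>: "\<xi> \<in> space \<mu>" and *: "indicator N (\<xi> - L) / gibbs_norm \<Phi> L (\<xi> - L) = 0"
    have c: "\<xi> - L \<in> configs" using \<xi> by (auto simp: sp intro: configs_subset)
    then have "gibbs_norm \<Phi> L (\<xi> - L) < \<infinity>"
      using assms gibbs_norm_finite by blast
    \<comment> \<open>A quotient in \<open>ennreal\<close> also vanishes when the denominator is
      infinite; finiteness of the normalizer rules this out.\<close>
    then have "\<xi> - L \<notin> N" using * by (auto simp: ennreal_divide_eq_0_iff)
    then show "P (\<xi> - L)" using N(1) c by (auto simp: sp)
  qed
qed

text \<open>Both probabilities are expanded by the DLR equation on \<open>ball x (r + s)\<close>:
  the one with the empty ball is given by the zero-point term, the other is at least its one-point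
  term. A point of \<open>ball x s\<close> has distance at least \<open>r\<close> from everything
  outside \<open>ball x (r + s)\<close>, so its weight is at least \<open>c\<close>; integrating
  over \<open>ball x s\<close> gives the factor.\<close>

lemma void_event_bound:
  assumes pot: "potential \<Phi>" and gm: "gibbs_measure \<Phi> \<mu>" and ci: "has_cond_intensity \<Phi> f"
    and P: "\<And>y. AE \<xi> in \<mu>. point_dist y \<xi> \<ge> ereal r \<longrightarrow> f y \<xi> \<ge> c"
    and A: "A \<in> sets config_algebra"
    and A_out: "\<And>\<xi>. \<xi> \<in> configs \<Longrightarrow> \<xi> \<in> A \<longleftrightarrow> \<xi> - ball x (r + s) \<in> A"
    and "r \<ge> 0"
  shows "ennreal c * emeasure lborel (ball x s) *
           emeasure \<mu> (A \<inter> {\<xi> \<in> configs. \<xi> \<inter> ball x (r + s) = {}}) \<le> emeasure \<mu> A"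
proof -
  define L where "L = ball x (r + s)"
  define V where "V = {\<xi> \<in> configs. \<xi> \<inter> L = {}}"
  have bb: "bounded_borel L" by (simp add: L_def bounded_borel_ball)
  have L: "L \<in> sets borel" by (simp add: L_def)
  have sets: "sets \<mu> = sets config_algebra" using gm by (simp add: gibbs_measure_def)
  have sp: "space \<mu> = configs" using sets_eq_imp_space_eq[OF sets] by simp
  note [measurable_cong] = sets
  note [measurable] = measurable_remove[OF L] gibbs_norm_measurable[OF pot bb] A
  have conf: "\<xi> - L \<in> configs" if "\<xi> \<in> configs" for \<xi>
    using that by (auto intro: configs_subset)
  have DLR: "emeasure \<mu> B = (\<integral>\<^sup>+\<xi>. gibbs_spec \<Phi> L (\<xi> - L) B \<partial>\<mu>)" if "B \<in> sets config_algebra" for B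
    using gm bb that by (simp add: gibbs_measure_def)
  interpret T: sigma_finite_measure "tuples L (Suc 0)" by (rule sigma_finite_tuples[OF L])
  interpret mu: prob_space \<mu> using gm by (simp add: gibbs_measure_def)
  interpret pair_sigma_finite "tuples L (Suc 0)" \<mu> ..
  \<comment> \<open>This is the conditional probability, given the configuration outside
    \<open>L\<close>, that \<open>A\<close> holds and \<open>L\<close> is empty.\<close>
  define g where "g \<xi> = indicator A (\<xi> - L) / gibbs_norm \<Phi> L (\<xi> - L)" for \<xi>
  have [measurable]: "g \<in> borel_measurable config_algebra" unfolding g_def by measurable
  have V: "V \<in> sets config_algebra" unfolding V_def by (rule void_event_sets[OF bb])
  define w where "w x \<xi> = ennreal (gibbs_weight \<Phi> (\<xi> - L) {x (0::nat)})" for x \<xi>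
  have w_meas[measurable]: "(\<lambda>(x, \<xi>). w x \<xi>) \<in> borel_measurable (tuples L (Suc 0) \<Otimes>\<^sub>M config_algebra)"
    using gibbs_weight_measurable[OF pot bb, of "Suc 0"]
    by (simp add: lessThan_Suc w_def split_beta')
  have "emeasure \<mu> (A \<inter> V) = (\<integral>\<^sup>+\<xi>. gibbs_spec \<Phi> L (\<xi> - L) (A \<inter> V) \<partial>\<mu>)"
    using A V by (intro DLR) auto
  also have "\<dots> = (\<integral>\<^sup>+\<xi>. g \<xi> \<partial>\<mu>)"
  proof (rule nn_integral_cong)
    fix \<xi> assume "\<xi> \<in> space \<mu>"
    then have "\<xi> - L \<in> V" using conf by (auto simp: V_def sp)
    then show "gibbs_spec \<Phi> L (\<xi> - L) (A \<inter> V) = g \<xi>"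
      by (subst gibbs_spec_void) (auto simp: V_def g_def indicator_def)
  qed
  finally have void: "emeasure \<mu> (A \<inter> V) = (\<integral>\<^sup>+\<xi>. g \<xi> \<partial>\<mu>)" .
  have weight: "AE \<xi> in \<mu>. ennreal c * indicator (ball x s) (t 0) * g \<xi> \<le> w t \<xi> * g \<xi>"
    if t: "t \<in> space (tuples L (Suc 0))" for t
  proof (cases "t 0 \<in> ball x s")
    case True
    have "t 0 \<in> L" using t by (auto simp: tuples_def space_PiM space_restrict_space)
    \<comment> \<open>Condition (P) is an almost sure statement about \<open>\<xi>\<close>, whereas
      the weight is taken at \<open>\<xi> - L\<close>.\<close>
    have "AE \<xi> in \<mu>. point_dist (t 0) (\<xi> - L) \<ge> ereal r \<longrightarrow> f (t 0) (\<xi> - L) \<ge> c"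
      using AE_remove[OF pot gm bb P] .
    then show ?thesis
    proof (rule AE_mp, intro AE_I2 impI)
      fix \<xi> assume \<xi>: "\<xi> \<in> space \<mu>"
        and *: "point_dist (t 0) (\<xi> - L) \<ge> ereal r \<longrightarrow> f (t 0) (\<xi> - L) \<ge> c"
      have "r \<le> dist (t 0) y" if "y \<in> \<xi> - L" for y
        using that True dist_triangle[of x y "t 0"] by (auto simp: L_def)
      then have "point_dist (t 0) (\<xi> - L) \<ge> ereal r"
        unfolding point_dist_def by (intro INF_greatest) auto
      \<comment> \<open>Intensities agree only off the configuration; \<open>t 0\<close> lies in
        \<open>L\<close>, hence not in \<open>\<xi> - L\<close>.\<close>
      moreover have "gibbs_weight \<Phi> (\<xi> - L) {t 0} = f (t 0) (\<xi> - L)"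
        using ci \<xi> conf \<open>t 0 \<in> L\<close> by (simp add: gibbs_weight_singleton has_cond_intensity_def sp)
      ultimately show "ennreal c * indicator (ball x s) (t 0) * g \<xi> \<le> w t \<xi> * g \<xi>"
        using * True by (auto simp: w_def intro!: mult_right_mono ennreal_leI)
    qed
  qed simp
  have "ennreal c * emeasure lborel (ball x s) * emeasure \<mu> (A \<inter> V)
      = ennreal c * (\<integral>\<^sup>+t. indicator (ball x s \<inter> L) (t 0) \<partial>tuples L (Suc 0)) * (\<integral>\<^sup>+\<xi>. g \<xi> \<partial>\<mu>)"
  proof -
    have "ball x s \<inter> L = ball x s" using \<open>r \<ge> 0\<close> by (auto simp: L_def)
    moreover have "(\<integral>\<^sup>+t. indicator (ball x s) (t 0) \<partial>tuples L (Suc 0)) = emeasure lborel (ball x s)"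
      using calculation by (intro emeasure_tuples_singleton L) auto
    ultimately show ?thesis by (simp add: void)
  qed
  also have "\<dots> = (\<integral>\<^sup>+t. ennreal c * indicator (ball x s \<inter> L) (t 0) * (\<integral>\<^sup>+\<xi>. g \<xi> \<partial>\<mu>) \<partial>tuples L (Suc 0))"
  proof -
    have [measurable]: "(\<lambda>t. indicator (ball x s \<inter> L) (t 0) :: ennreal) \<in> borel_measurable (tuples L (Suc 0))"
    proof -
      have "(\<lambda>t. t 0) \<in> tuples L (Suc 0) \<rightarrow>\<^sub>M restrict_space lborel L"
        unfolding tuples_def by (rule measurable_component_singleton) auto
      then have "(\<lambda>t. t 0) \<in> tuples L (Suc 0) \<rightarrow>\<^sub>M borel"
        by (auto simp: measurable_restrict_space2_iff)
      then show ?thesis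
        by (rule measurable_compose) (intro borel_measurable_indicator sets.Int borel_open open_ball L)
    qed
    show ?thesis by (simp add: nn_integral_cmult nn_integral_multc)
  qed
  also have "\<dots> \<le> (\<integral>\<^sup>+t. (\<integral>\<^sup>+\<xi>. ennreal c * indicator (ball x s) (t 0) * g \<xi> \<partial>\<mu>) \<partial>tuples L (Suc 0))"
    by (intro nn_integral_mono, subst nn_integral_cmult) (auto simp: indicator_def)
  \<comment> \<open>The null set in \<open>weight\<close> depends on \<open>t\<close>, so the
    integral over \<open>\<xi>\<close> has to be the inner one here; the order is exchanged
    afterwards.\<close>
  also have "\<dots> \<le> (\<integral>\<^sup>+t. (\<integral>\<^sup>+\<xi>. w t \<xi> * g \<xi> \<partial>\<mu>) \<partial>tuples L (Suc 0))"
    by (intro nn_integral_mono nn_integral_mono_AE weight)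
  also have "\<dots> = (\<integral>\<^sup>+\<xi>. (\<integral>\<^sup>+t. w t \<xi> * g \<xi> \<partial>tuples L (Suc 0)) \<partial>\<mu>)"
    by (rule Fubini'[symmetric]) measurable
  also have "\<dots> \<le> (\<integral>\<^sup>+\<xi>. gibbs_spec \<Phi> L (\<xi> - L) A \<partial>\<mu>)"
  proof (rule nn_integral_mono)
    fix \<xi> assume "\<xi> \<in> space \<mu>"
    then have \<xi>: "\<xi> \<in> configs" by (simp add: sp)
    have "(\<integral>\<^sup>+t. w t \<xi> * g \<xi> \<partial>tuples L (Suc 0)) = (\<integral>\<^sup>+t. w t \<xi> \<partial>tuples L (Suc 0)) * g \<xi>"
      by (rule nn_integral_multc) (use measurable_Pair1[OF w_meas, of \<xi>] \<xi> in simp)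
    also have "\<dots> = (\<integral>\<^sup>+t. w t \<xi> \<partial>tuples L (Suc 0)) * indicator A (\<xi> - L) / gibbs_norm \<Phi> L (\<xi> - L)"
      by (simp add: g_def ennreal_times_divide)
    also have "\<dots> \<le> (\<integral>\<^sup>+t. indicator A (insert (t 0) (\<xi> - L)) * w t \<xi> \<partial>tuples L (Suc 0)) / gibbs_norm \<Phi> L (\<xi> - L)"
    proof (rule divide_right_mono_ennreal)
      \<comment> \<open>By \<open>A_out\<close> the event \<open>A\<close> does not see the point
        added inside \<open>L\<close>.\<close>
      have "indicator A (insert (t 0) (\<xi> - L)) = (indicator A (\<xi> - L) :: ennreal)"
        if "t \<in> space (tuples L (Suc 0))" for t
      proof -
        have "t 0 \<in> L" using that by (auto simp: tuples_def space_PiM space_restrict_space)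
        then have eq: "insert (t 0) (\<xi> - L) - L = \<xi> - L" by auto
        have "insert (t 0) (\<xi> - L) \<in> A \<longleftrightarrow> insert (t 0) (\<xi> - L) - L \<in> A"
          unfolding L_def by (rule A_out) (use insert_configs conf[OF \<xi>] in \<open>simp add: L_def\<close>)
        then show ?thesis by (simp add: eq indicator_def)
      qed
      then have "(\<integral>\<^sup>+t. indicator A (insert (t 0) (\<xi> - L)) * w t \<xi> \<partial>tuples L (Suc 0))
          = (\<integral>\<^sup>+t. indicator A (\<xi> - L) * w t \<xi> \<partial>tuples L (Suc 0))"
        by (intro nn_integral_cong) simp
      also have "\<dots> = (\<integral>\<^sup>+t. w t \<xi> \<partial>tuples L (Suc 0)) * indicator A (\<xi> - L)"
        by (cases "\<xi> - L \<in> A") simp_all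
      finally show "(\<integral>\<^sup>+t. w t \<xi> \<partial>tuples L (Suc 0)) * indicator A (\<xi> - L)
          \<le> (\<integral>\<^sup>+t. indicator A (insert (t 0) (\<xi> - L)) * w t \<xi> \<partial>tuples L (Suc 0))"
        by simp
    qed
    also have "\<dots> \<le> gibbs_spec \<Phi> L (\<xi> - L) A"
      unfolding w_def by (rule gibbs_spec_ge_single)
    finally show "(\<integral>\<^sup>+t. w t \<xi> * g \<xi> \<partial>tuples L (Suc 0)) \<le> gibbs_spec \<Phi> L (\<xi> - L) A" .
  qed
  also have "\<dots> = emeasure \<mu> A" using DLR[OF A] by simp
  finally show ?thesis by (simp add: V_def L_def)
qed

text \<open>Induction on \<open>I\<close>: \<open>void_event_bound\<close> is applied to the event
  that the earlier balls are empty. The separation makes these balls disjoint from the new one, so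
  that event is determined outside the new ball, and each ball contributes one factor.\<close>

lemma void_events_bound:
  assumes pot: "potential \<Phi>" and gm: "gibbs_measure \<Phi> \<mu>" and ci: "has_cond_intensity \<Phi> f"
    and P: "\<And>y. AE \<xi> in \<mu>. point_dist y \<xi> \<ge> ereal r \<longrightarrow> f y \<xi> \<ge> c"
    and "r \<ge> 0" and c: "c * measure lborel (ball (0::'a::euclidean_space) s) > 0"
    and "finite I"
    and sep: "\<And>x y. x \<in> I \<Longrightarrow> y \<in> I \<Longrightarrow> x \<noteq> y \<Longrightarrow> dist x y \<ge> 2 * (r + s)"
  shows "measure \<mu> {\<xi> \<in> configs. \<forall>x\<in>I. \<xi> \<inter> ball (x::'a) (r + s) = {}}
           \<le> (1 / (c * measure lborel (ball (0::'a) s))) ^ card I"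
  using \<open>finite I\<close> sep
proof (induction I)
  case empty
  interpret mu: prob_space \<mu> using gm by (simp add: gibbs_measure_def)
  show ?case by simp
next
  case (insert x I)
  interpret mu: prob_space \<mu> using gm by (simp add: gibbs_measure_def)
  define q where "q = c * measure lborel (ball (0::'a) s)"
  have "q > 0" using c by (simp add: q_def)
  have "c > 0" using c by (simp add: zero_less_mult_iff)
  define A where "A = {\<xi> \<in> configs. \<forall>x\<in>I. \<xi> \<inter> ball (x::'a) (r + s) = {}}"
  have A: "A \<in> sets config_algebra"
    unfolding A_def by (rule void_events_sets[OF \<open>finite I\<close>])
  have out: "\<xi> \<in> A \<longleftrightarrow> \<xi> - ball x (r + s) \<in> A" if "\<xi> \<in> configs" for \<xi>
  proof -
    have "ball y (r + s) \<inter> ball x (r + s) = {}" if "y \<in> I" for y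
      using insert.prems[of x y] insert.hyps that by (intro disjoint_ballI) (auto simp: dist_commute)
    moreover have "\<xi> - ball x (r + s) \<in> configs"
      using that by (auto intro: configs_subset)
    ultimately show ?thesis using that unfolding A_def by blast
  qed
  have IH: "measure \<mu> A \<le> (1 / q) ^ card I"
    unfolding A_def q_def using insert.prems by (intro insert.IH) auto
  \<comment> \<open>Translation invariance makes the factor independent of the centre.\<close>
  have m: "emeasure lborel (ball x s) = ennreal (measure lborel (ball (0::'a) s))"
  proof -
    have "ball x s = (+) x ` ball 0 s" by simp
    then have "measure lebesgue (ball x s) = measure lebesgue (ball (0::'a) s)"
      by (simp only: measure_translation)
    moreover have "emeasure lborel (ball x s) \<noteq> top"
      using emeasure_lborel_ball_finite[of x s] by simp
    ultimately show ?thesis by (simp add: emeasure_eq_ennreal_measure)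
  qed
  define B where "B = A \<inter> {\<xi> \<in> configs. \<xi> \<inter> ball x (r + s) = {}}"
  have "ennreal q * ennreal (measure \<mu> B) \<le> ennreal (measure \<mu> A)"
    using void_event_bound[OF pot gm ci P A out \<open>r \<ge> 0\<close>] \<open>c > 0\<close>
    unfolding m B_def[symmetric] mu.emeasure_eq_measure by (simp add: q_def ennreal_mult)
  then have "q * measure \<mu> B \<le> measure \<mu> A"
    using \<open>q > 0\<close> by (simp add: ennreal_mult[symmetric])
  then have "measure \<mu> B \<le> 1 / q * measure \<mu> A"
    using \<open>q > 0\<close> by (simp add: field_simps)
  also have "\<dots> \<le> 1 / q * (1 / q) ^ card I"
    using IH \<open>q > 0\<close> by (intro mult_left_mono) auto
  also have "\<dots> = (1 / q) ^ card (insert x I)"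
    using insert.hyps by simp
  also have "B = {\<xi> \<in> configs. \<forall>y\<in>insert x I. \<xi> \<inter> ball y (r + s) = {}}"
    by (auto simp: A_def B_def)
  finally show ?case by (simp only: q_def)
qed

section \<open>Separated chains in a surrounding set\<close>

text \<open>A maximal \<open>D\<close>-separated set \<open>T\<close> is \<open>2 * D\<close>-dense
  in \<open>S\<close>. If the points of \<open>T\<close> reachable from \<open>p\<close> by jumps of
  at most \<open>4 * D\<close> left part of \<open>S\<close> uncovered, the closed
  \<open>2 * D\<close>-balls around reachable and unreachable points would disconnect
  \<open>S\<close>.\<close>

lemma separated_chain:
  fixes S :: "'a::metric_space set"
  assumes "compact S" "connected S" "p \<in> S" "q \<in> S" "D > 0"
  obtains xs y where
    "rtrancl_path (\<lambda>x y. dist x y \<le> 4 * D) p xs y" "distinct (p # xs)" "set xs \<subseteq> S"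
    "\<And>x y. x \<in> set (p # xs) \<Longrightarrow> y \<in> set (p # xs) \<Longrightarrow> x \<noteq> y \<Longrightarrow> dist x y \<ge> D"
    "dist y q \<le> 2 * D"
proof -
  obtain K where K: "finite K" "K \<subseteq> S" "S \<subseteq> (\<Union>x\<in>K. ball x D)"
    using compactE_image[OF assms(1), of S "\<lambda>x. ball x D"] assms(5)
    by (smt (verit, best) UN_iff centre_in_ball open_ball subsetI)
  \<comment> \<open>Restricting to subsets of a finite net makes the family finite, so a maximal
    separated set containing \<open>p\<close> exists.\<close>
  define \<T> where "\<T> = {T. T \<subseteq> insert p K \<and> p \<in> T \<and> (\<forall>x\<in>T. \<forall>y\<in>T. x \<noteq> y \<longrightarrow> dist x y \<ge> D)}"
  have "finite \<T>" unfolding \<T>_def using K(1) by (auto intro: finite_subset[of _ "Pow (insert p K)"])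
  moreover have "{p} \<in> \<T>" by (auto simp: \<T>_def)
  ultimately obtain T where T: "T \<in> \<T>" and Tmax: "\<And>U. U \<in> \<T> \<Longrightarrow> T \<subseteq> U \<Longrightarrow> U = T"
    using finite_has_maximal2[of \<T> "{p}"] by blast
  have finT: "finite T" using T K(1) by (auto simp: \<T>_def intro: finite_subset)
  have TS: "T \<subseteq> S" using T K(2) assms(3) by (auto simp: \<T>_def)
  \<comment> \<open>One \<open>D\<close> is spent from \<open>x\<close> to the net, the other from
    the net to \<open>T\<close> by maximality.\<close>
  have cover: "\<exists>t\<in>T. dist t x < 2 * D" if x: "x \<in> S" for x
  proof -
    obtain k where k: "k \<in> K" "dist k x < D" using K(3) x by auto
    have "\<exists>t\<in>T. dist t k < D"
    proof (cases "k \<in> T")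
      case False
      then have *: "insert k T \<notin> \<T>" using Tmax[of "insert k T"] by auto
      show ?thesis
      proof (rule ccontr)
        assume "\<not> ?thesis"
        then have far: "dist t k \<ge> D" "dist k t \<ge> D" if "t \<in> T" for t
          using that by (auto simp: dist_commute not_less)
        have "insert k T \<in> \<T>" using T k(1) far by (simp add: \<T>_def)
        with * show False ..
      qed
    qed (use assms(5) in \<open>auto intro: bexI[of _ k]\<close>)
    then obtain t where "t \<in> T" "dist t k < D" by blast
    then show ?thesis using k(2) dist_triangle[of t x k] by (intro bexI[of _ t]) auto
  qed
  define R where "R x y \<longleftrightarrow> y \<in> T \<and> dist x y \<le> 4 * D" for x y
  define T1 where "T1 = {t \<in> T. R\<^sup>*\<^sup>* p t}"
  define T2 where "T2 = T - T1"
  define E1 where "E1 = (\<Union>t\<in>T1. cball t (2 * D))"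
  define E2 where "E2 = (\<Union>t\<in>T2. cball t (2 * D))"
  have "closed E1" "closed E2"
    unfolding E1_def E2_def using finT by (auto simp: T1_def T2_def)
  moreover have "S \<subseteq> E1 \<union> E2"
  proof
    fix x assume "x \<in> S"
    then obtain t where "t \<in> T" "dist t x < 2 * D" using cover by blast
    then have "x \<in> cball t (2 * D)" "t \<in> T1 \<union> T2" by (auto simp: T2_def)
    then show "x \<in> E1 \<union> E2" unfolding E1_def E2_def by blast
  qed
  \<comment> \<open>Two \<open>2 * D\<close>-balls with a common point have centres at distance at
    most \<open>4 * D\<close>, so one centre is reachable from the other.\<close>
  moreover have "E1 \<inter> E2 \<inter> S = {}"
  proof -
    have False if "t \<in> T1" "u \<in> T2" "dist t x \<le> 2 * D" "dist u x \<le> 2 * D" for t u x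
    proof -
      have "R t u" using that dist_triangle2[of t u x] by (auto simp: R_def T2_def)
      then have "u \<in> T1" using that(1) rtranclp.rtrancl_into_rtrancl[of R p t u]
        by (simp add: T1_def) (simp add: R_def)
      then show False using that(2) by (simp add: T2_def)
    qed
    then show ?thesis unfolding E1_def E2_def by (auto simp del: dist_eq_0_iff)
  qed
  moreover have "p \<in> E1 \<inter> S"
    using T assms(3,5) by (auto simp: E1_def T1_def \<T>_def intro!: bexI[of _ p])
  ultimately have "E2 \<inter> S = {}"
    using assms(2) unfolding connected_closed by blast
  then have q: "q \<in> E1" using assms(4) \<open>S \<subseteq> E1 \<union> E2\<close> by auto
  then obtain y where y: "y \<in> T" "R\<^sup>*\<^sup>* p y" "dist y q \<le> 2 * D" by (auto simp: E1_def T1_def)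
  obtain xs' where "rtrancl_path R p xs' y" using y(2) rtranclp_eq_rtrancl_path by metis
  \<comment> \<open>Cutting out loops makes the vertices distinct.\<close>
  then obtain xs where xs: "rtrancl_path R p xs y" "distinct (p # xs)"
    by (rule rtrancl_path_distinct)
  have xsT: "set xs \<subseteq> T"
    using rtrancl_path_Range[OF xs(1)] by (auto simp: R_def Rangep.simps)
  show ?thesis
  proof
    show "rtrancl_path (\<lambda>x y. dist x y \<le> 4 * D) p xs y"
      using xs(1) by (rule rtrancl_path_mono) (simp add: R_def)
    show "dist x y \<ge> D" if "x \<in> set (p # xs)" "y \<in> set (p # xs)" "x \<noteq> y" for x y
      using that xsT T unfolding \<T>_def by auto
  qed (use xs xsT TS y in auto)
qed

text \<open>Serves as a lower bound on the length: a chain between distant points has many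
  steps.\<close>

lemma rtrancl_path_dist_le:
  assumes "rtrancl_path (\<lambda>x y. dist x y \<le> d) p xs y"
  shows "dist p y \<le> d * length xs"
  using assms
proof induction
  case (step x y ys z)
  then show ?case using dist_triangle[of x z y] by (simp add: algebra_simps)
qed simp

text \<open>If all clusters are bounded, then the ball together with the clusters it meets is a
  bounded connected set, and by unicoherence of the space the outer boundary of that set is
  connected.\<close>

lemma surrounding_set:
  fixes e :: "'a::euclidean_space"
  assumes dim: "DIM('a) \<ge> 2" and \<xi>: "\<xi> \<in> configs" and n: "n > 0" and e: "norm e = 1"
    and no: "\<not> has_infinite_cluster (Z R \<xi>)"
  obtains S p q where "compact S" "connected S" "S \<inter> Z R \<xi> = {}" 
    "p *\<^sub>R e \<in> S" "- (q *\<^sub>R e) \<in> S" "p \<ge> n" "q \<ge> 0"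
proof -
  define W where "W = Z R \<xi>"
  have "open W" unfolding W_def Z_def by auto
  define \<C> where "\<C> = {C \<in> components W. C \<inter> ball 0 n \<noteq> {}}"
  \<comment> \<open>Written as a union of sets that all contain the ball, so that connectedness
    follows from a common point; the member \<open>{}\<close> keeps the ball present when no cluster
    meets it.\<close>
  define U where "U = \<Union>((\<union>) (ball 0 n) ` insert {} \<C>)"
  have U_eq: "U = ball 0 n \<union> \<Union>\<C>" by (auto simp: U_def)
  have opC: "open C" if "C \<in> components W" for C
    using open_components[OF \<open>open W\<close> that] .
  have "open U" using opC by (auto simp: U_eq \<C>_def)
  \<comment> \<open>A cluster meeting the ball contains a point of \<open>\<xi>\<close> within
    \<open>n + R\<close> of the origin, and there are finitely many of these. Finiteness is what
    makes the union of the bounded clusters bounded.\<close>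
  have "finite \<C>"
  proof (rule finite_subset)
    show "\<C> \<subseteq> connected_component_set W ` (\<xi> \<inter> ball 0 (n + R))"
    proof
      fix C assume C: "C \<in> \<C>"
      then obtain z where z: "z \<in> C" "norm z < n" "C \<in> components W" by (auto simp: \<C>_def)
      then have "z \<in> W" using in_components_subset by blast
      then obtain x where x: "x \<in> \<xi>" "dist x z < R" by (auto simp: W_def Z_def)
      have R: "R > 0" using x(2) zero_le_dist[of x z] by linarith
      have "norm x < n + R" using x(2) z(2) norm_triangle_sub[of x z] by (simp add: dist_norm)
      moreover have "C = connected_component_set W x"
      proof -
        have "C = connected_component_set W z"
          using z by (metis components_iff connected_component_eq)
        moreover have "connected_component W x z"
          using x R by (auto intro!: connected_componentI[of "ball x R"] simp: W_def Z_def)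
        ultimately show ?thesis by (metis connected_component_eq mem_Collect_eq)
      qed
      ultimately show "C \<in> connected_component_set W ` (\<xi> \<inter> ball 0 (n + R))"
        using x(1) by auto
    qed
    show "finite (connected_component_set W ` (\<xi> \<inter> ball 0 (n + R)))"
      using \<xi> by (auto simp: configs_def)
  qed
  then have "bounded U"
    using no unfolding U_eq by (auto simp: \<C>_def has_infinite_cluster_def W_def intro!: bounded_Union)
  have "connected U"
    unfolding U_def
  proof (rule connected_Union)
    show "connected s" if "s \<in> (\<union>) (ball 0 n) ` insert {} \<C>" for s
      using that by (auto simp: \<C>_def intro!: connected_Un dest: in_components_connected)
    show "\<Inter> ((\<union>) (ball 0 n) ` insert {} \<C>) \<noteq> {}"
      using n by (auto intro!: exI[of _ 0])
  qed
  obtain M where M: "M > 0" "U \<subseteq> ball 0 M"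
    using \<open>bounded U\<close> by (meson bounded_subset_ballD)
  define C where "C = connected_component_set (- U) (M *\<^sub>R e)"
  \<comment> \<open>In dimension at least 2 the complement of a ball is connected, so a single
    component of \<open>- U\<close> contains all far points.\<close>
  have far: "- ball 0 M \<subseteq> C"
    unfolding C_def
  proof (rule connected_component_maximal)
    show "connected (- ball 0 M :: 'a set)"
      using dim by (intro connected_complement_bounded_convex) auto
  qed (use M e in auto)
  have CU: "C \<inter> U = {}" using connected_component_subset[of "- U" "M *\<^sub>R e"] unfolding C_def by blast
  have "C \<in> components (- U)"
    unfolding C_def using M e by (intro componentsI) (auto simp: subset_iff)
  \<comment> \<open>Unicoherence enters here: \<open>C\<close> is a component of the complement of a
    connected set.\<close>
  then have "connected (frontier C)"
    using connected_frontier_component_complement[OF \<open>connected U\<close>] by blast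
  have fr: "frontier C \<subseteq> frontier U"
    using frontier_of_components_subset[OF \<open>C \<in> components (- U)\<close>] by (simp add: frontier_complement)
  have "compact (frontier C)"
  proof -
    have "bounded (frontier U)"
      using \<open>bounded U\<close> by (simp add: frontier_def bounded_closure bounded_subset[OF _ Diff_subset])
    then show ?thesis using fr bounded_subset compact_eq_bounded_closed by (metis frontier_closed)
  qed
  \<comment> \<open>A cluster through a frontier point of the open set \<open>U\<close> is not among
    those in \<open>U\<close>, hence is disjoint from \<open>U\<close>; being open, it misses the
    closure as well.\<close>
  have disj: "z \<notin> W" if "z \<in> frontier U" for z
  proof
    assume "z \<in> W"
    define K where "K = connected_component_set W z"
    have K: "z \<in> K" "K \<in> components W"
      using \<open>z \<in> W\<close> by (auto simp: K_def componentsI)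
    have "z \<notin> U" "z \<in> closure U"
      using that \<open>open U\<close> by (auto simp: frontier_def interior_open)
    have "K \<inter> ball 0 n = {}" using K \<open>z \<notin> U\<close> by (auto simp: U_eq \<C>_def)
    moreover have "K \<inter> K' = {}" if "K' \<in> \<C>" for K'
      using that K components_nonoverlap[of K W K'] \<open>K \<inter> ball 0 n = {}\<close> by (auto simp: \<C>_def)
    ultimately have "K \<inter> U = {}" by (auto simp: U_eq)
    then have "K \<inter> closure U = {}" using opC[OF K(2)] by (simp add: open_Int_closure_eq_empty)
    then show False using K(1) \<open>z \<in> closure U\<close> by auto
  qed
  \<comment> \<open>The ray starts in \<open>U\<close>, outside \<open>C\<close>, and is in
    \<open>C\<close> at distance \<open>M\<close>. It crosses the frontier of \<open>C\<close>
    outside \<open>U\<close>, so at distance at least \<open>n\<close>.\<close>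
  have ray: "\<exists>t\<ge>n. t *\<^sub>R u \<in> frontier C" if u: "norm u = 1" for u
  proof -
    have "(\<lambda>t. t *\<^sub>R u) ` {0..M} \<inter> frontier C \<noteq> {}"
    proof (rule connected_Int_frontier)
      show "connected ((\<lambda>t. t *\<^sub>R u) ` {0..M})"
        by (intro connected_continuous_image continuous_intros) auto
      have "M *\<^sub>R u \<in> C" using u M by (intro subsetD[OF far]) auto
      then show "(\<lambda>t. t *\<^sub>R u) ` {0..M} \<inter> C \<noteq> {}"
        using M by (intro ex_in_conv[THEN iffD1] exI[of _ "M *\<^sub>R u"]) auto
      have "0 \<in> U" using n by (simp add: U_eq)
      then have "0 *\<^sub>R u \<notin> C" using CU by auto
      then show "(\<lambda>t. t *\<^sub>R u) ` {0..M} - C \<noteq> {}" using M by force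
    qed
    then obtain t where t: "t \<ge> 0" "t *\<^sub>R u \<in> frontier C" by auto
    then have "t *\<^sub>R u \<notin> U" using fr \<open>open U\<close> by (auto simp: frontier_def interior_open)
    then have "t \<ge> n" using t u by (auto simp: U_eq)
    then show ?thesis using t by blast
  qed
  obtain p where p: "p \<ge> n" "p *\<^sub>R e \<in> frontier C" using ray[OF e] by blast
  obtain q where q: "q \<ge> n" "q *\<^sub>R - e \<in> frontier C" using ray[of "- e"] e by auto
  show ?thesis
    using that[of "frontier C" p q] p q n \<open>compact (frontier C)\<close> \<open>connected (frontier C)\<close> disj fr
    by (auto simp: W_def)
qed

section \<open>Counting lattice paths\<close>

text \<open>The lattice has mesh \<open>h / DIM('a)\<close>: rounding down moves each coordinate by
  at most the mesh, and the coordinate errors add up to at most \<open>h\<close>. Closure under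
  differences confines the increments of rounded chains to one finite set.\<close>

lemma lattice_rounding:
  assumes "h > 0"
  obtains G :: "'a::euclidean_space set" and g where
    "\<And>x y. x \<in> G \<Longrightarrow> y \<in> G \<Longrightarrow> x - y \<in> G" "\<And>B. bounded B \<Longrightarrow> finite (G \<inter> B)"
    "\<And>x. g x \<in> G" "\<And>x. dist (g x) x \<le> h"
proof -
  define a where "a = h / DIM('a)"
  have a: "a > 0" using assms by (simp add: a_def)
  define G :: "'a set" where "G = {x. \<forall>b\<in>Basis. x \<bullet> b \<in> range (\<lambda>k::int. a * k)}"
  define g :: "'a \<Rightarrow> 'a" where "g x = (\<Sum>b\<in>Basis. (a * \<lfloor>x \<bullet> b / a\<rfloor>) *\<^sub>R b)" for x
  have gb: "g x \<bullet> b = a * \<lfloor>x \<bullet> b / a\<rfloor>" if "b \<in> Basis" for x b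
    using that by (simp add: g_def inner_sum_left_Basis)
  show ?thesis
  proof
    show "x - y \<in> G" if "x \<in> G" "y \<in> G" for x y
    proof -
      have "(x - y) \<bullet> b \<in> range (\<lambda>k::int. a * k)" if b: "b \<in> Basis" for b
      proof -
        obtain k l :: int where "x \<bullet> b = a * k" "y \<bullet> b = a * l"
          using \<open>x \<in> G\<close> \<open>y \<in> G\<close> b unfolding G_def by blast
        then have "(x - y) \<bullet> b = a * (k - l)" by (simp add: inner_diff_left algebra_simps)
        then show ?thesis by (metis of_int_diff rangeI)
      qed
      then show ?thesis by (simp add: G_def)
    qed
    show "g x \<in> G" for x unfolding G_def by (auto simp: gb)
    show "dist (g x) x \<le> h" for x
    proof -
      have "\<bar>(g x - x) \<bullet> b\<bar> \<le> a" if b: "b \<in> Basis" for b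
      proof -
        define k where "k = real_of_int \<lfloor>x \<bullet> b / a\<rfloor>"
        have "k \<le> x \<bullet> b / a" "x \<bullet> b / a \<le> k + 1"
          unfolding k_def by (rule of_int_floor_le, rule real_of_int_floor_add_one_ge)
        then have "a * k \<le> x \<bullet> b" "x \<bullet> b \<le> a * k + a"
          using a by (auto simp: pos_le_divide_eq pos_divide_le_eq algebra_simps)
        then show ?thesis by (simp add: inner_diff_left gb[OF b] flip: k_def)
      qed
      then have "(\<Sum>b\<in>Basis. \<bar>(g x - x) \<bullet> b\<bar>) \<le> DIM('a) * a"
        by (intro sum_bounded_above)
      also have "\<dots> = h" by (simp add: a_def)
      finally show ?thesis using norm_le_l1[of "g x - x"] unfolding dist_norm by (rule order_trans[rotated])
    qed
    show "finite (G \<inter> B)" if bB: "bounded B" for B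
    proof -
      obtain M where M: "\<And>x. x \<in> B \<Longrightarrow> norm x \<le> M" using bB unfolding bounded_iff by blast
      define J where "J = (\<lambda>k::int. a * k) ` {- \<lfloor>M / a\<rfloor>..\<lfloor>M / a\<rfloor>}"
      have "G \<inter> B \<subseteq> (\<lambda>c. \<Sum>b\<in>Basis. c b *\<^sub>R b) ` (Basis \<rightarrow>\<^sub>E J)"
      proof
        fix x assume x: "x \<in> G \<inter> B"
        have "x \<bullet> b \<in> J" if b: "b \<in> Basis" for b
        proof -
          obtain k :: int where k: "x \<bullet> b = a * k" using x b by (auto simp: G_def)
          have "\<bar>a * k\<bar> \<le> M" using k M[of x] x Basis_le_norm[OF b, of x] by auto
          then have "\<bar>real_of_int k\<bar> \<le> M / a" using a by (simp add: abs_mult pos_le_divide_eq mult.commute)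
          then have "of_int k \<le> M / a" "of_int (- k) \<le> M / a" by (simp_all add: abs_le_iff)
          then have "k \<le> \<lfloor>M / a\<rfloor>" "- k \<le> \<lfloor>M / a\<rfloor>" unfolding le_floor_iff .
          then have "k \<in> {- \<lfloor>M / a\<rfloor>..\<lfloor>M / a\<rfloor>}" by simp
          then show ?thesis unfolding k J_def by (rule imageI)
        qed
        then have "restrict (\<lambda>b. x \<bullet> b) Basis \<in> Basis \<rightarrow>\<^sub>E J" by (simp add: restrict_PiE_iff)
        moreover have "x = (\<Sum>b\<in>Basis. restrict (\<lambda>b. x \<bullet> b) Basis b *\<^sub>R b)"
          by (simp add: euclidean_representation)
        ultimately show "x \<in> (\<lambda>c. \<Sum>b\<in>Basis. c b *\<^sub>R b) ` (Basis \<rightarrow>\<^sub>E J)"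
          by (intro image_eqI[where x="restrict (\<lambda>b. x \<bullet> b) Basis"])
      qed
      moreover have "finite (Basis \<rightarrow>\<^sub>E J)" by (intro finite_PiE) (auto simp: J_def)
      ultimately show ?thesis by (rule finite_subset[OF _ finite_imageI])
    qed
  qed
qed

text \<open>\<open>(v # ys) ! i\<close> is the predecessor of \<open>ys ! i\<close>, so
  \<open>ys\<close> has one entry per step and \<open>N\<close> is the set of allowed
  increments.\<close>

definition lattice_paths :: "'a::ab_group_add set \<Rightarrow> nat \<Rightarrow> 'a \<Rightarrow> 'a list set" where
  "lattice_paths N k v = {ys. length ys = k \<and> (\<forall>i<k. ys ! i - (v # ys) ! i \<in> N)}"

lemma lattice_paths_Suc_subset:
  "lattice_paths N (Suc k) v \<subseteq> (\<Union>s\<in>N. (#) (v + s) ` lattice_paths N k (v + s))"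
proof
  fix ys assume ys: "ys \<in> lattice_paths N (Suc k) v"
  then obtain y zs where yz: "ys = y # zs" "length zs = k"
    by (auto simp: lattice_paths_def length_Suc_conv)
  have step: "ys ! i - (v # ys) ! i \<in> N" if "i < Suc k" for i
    using ys that by (simp add: lattice_paths_def)
  have "y - v \<in> N" using step[of 0] yz by simp
  moreover have "zs \<in> lattice_paths N k y"
    using step[of "Suc i" for i] yz by (auto simp: lattice_paths_def)
  ultimately show "ys \<in> (\<Union>s\<in>N. (#) (v + s) ` lattice_paths N k (v + s))"
    using yz(1) by (intro UN_I[of "y - v"]) auto
qed

text \<open>Each step has at most \<open>card N\<close> choices wherever it starts, which is why
  \<open>v\<close> is arbitrary in the induction.\<close>

lemma finite_card_lattice_paths:
  assumes "finite N"
  shows "finite (lattice_paths N k v) \<and> card (lattice_paths N k v) \<le> card N ^ k"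
proof (induction k arbitrary: v)
  case 0
  have "lattice_paths N 0 v = {[]}" by (auto simp: lattice_paths_def)
  then show ?case by simp
next
  case (Suc k)
  have fin: "finite (\<Union>s\<in>N. (#) (v + s) ` lattice_paths N k (v + s))"
    using assms Suc by blast
  have "card (lattice_paths N (Suc k) v) \<le> card (\<Union>s\<in>N. (#) (v + s) ` lattice_paths N k (v + s))"
    by (rule card_mono[OF fin lattice_paths_Suc_subset])
  also have "\<dots> \<le> (\<Sum>s\<in>N. card ((#) (v + s) ` lattice_paths N k (v + s)))"
    by (rule card_UN_le[OF assms])
  also have "\<dots> \<le> (\<Sum>s\<in>N. card N ^ k)"
    using Suc by (intro sum_mono order_trans[OF card_image_le]) auto
  finally show ?case
    using finite_subset[OF lattice_paths_Suc_subset fin] by simp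
qed

text \<open>The start of the path is the rounding of \<open>(4 * D * k) *\<^sub>R e\<close> instead of a point of \<open>S\<close>,
  so that it depends on \<open>k\<close> only; it need not be vacant and is not listed in \<open>ys\<close>.\<close>

lemma vacant_lattice_path:
  fixes G :: "'a::euclidean_space set"
  assumes S: "compact S" "connected S" and pS: "p *\<^sub>R e \<in> S" and qS: "- (q *\<^sub>R e) \<in> S"
    and e: "norm e = 1" and "q \<ge> 0" "\<rho> > 0" "h > 0"
    and D: "D = 2 * \<rho> + 2 * h" and k: "4 * D * real k \<le> p" "p \<le> 4 * D * real (Suc k)"
    and G: "\<And>x y. x \<in> G \<Longrightarrow> y \<in> G \<Longrightarrow> x - y \<in> G" "\<And>x. g x \<in> G" "\<And>x. dist (g x) x \<le> h"
  obtains ys where "ys \<in> lattice_paths (G \<inter> cball 0 (4 * D + 2 * h)) k (g ((4 * D * real k) *\<^sub>R e))"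
    "distinct ys" "\<And>x y. x \<in> set ys \<Longrightarrow> y \<in> set ys \<Longrightarrow> x \<noteq> y \<Longrightarrow> dist x y \<ge> 2 * \<rho>"
    "\<And>y. y \<in> set ys \<Longrightarrow> \<exists>x\<in>S. dist y x \<le> h"
proof -
  have "D > 0" using D assms by simp
  have "0 \<le> 4 * D * real k" using \<open>D > 0\<close> by simp
  then have "p \<ge> 0" using k(1) by linarith
  define v where "v = (4 * D * real k) *\<^sub>R e"
  obtain xs y where xs: "rtrancl_path (\<lambda>x y. dist x y \<le> 4 * D) (p *\<^sub>R e) xs y" "distinct (p *\<^sub>R e # xs)" "set xs \<subseteq> S"
    and sep: "\<And>x y. x \<in> set (p *\<^sub>R e # xs) \<Longrightarrow> y \<in> set (p *\<^sub>R e # xs) \<Longrightarrow> x \<noteq> y \<Longrightarrow> dist x y \<ge> D"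
    and y: "dist y (- (q *\<^sub>R e)) \<le> 2 * D"
    using separated_chain[OF S pS qS \<open>D > 0\<close>] by metis
  \<comment> \<open>The chain covers at least \<open>4 * D * k - 2 * D\<close> with steps of at most
    \<open>4 * D\<close>, so its length is at least \<open>k - 1 / 2\<close>, hence at least
    \<open>k\<close> by integrality.\<close>
  have "k \<le> length xs"
  proof -
    have "dist (p *\<^sub>R e) (- (q *\<^sub>R e)) = norm ((p + q) *\<^sub>R e)"
      by (simp add: dist_norm algebra_simps)
    also have "\<dots> = p + q"
      using e \<open>p \<ge> 0\<close> \<open>q \<ge> 0\<close> by simp
    finally have "4 * D * real k \<le> 4 * D * length xs + 2 * D"
      using rtrancl_path_dist_le[OF xs(1)] y k(1) \<open>q \<ge> 0\<close>
        dist_triangle[of "p *\<^sub>R e" "- (q *\<^sub>R e)" y] by linarith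
    then have "D * (4 * real k) \<le> D * (4 * length xs + 2)" by (simp add: algebra_simps)
    then have "4 * real k \<le> 4 * length xs + 2" using \<open>D > 0\<close> by simp
    then show ?thesis by linarith
  qed
  \<comment> \<open>The first \<open>k\<close> vertices, with the starting vertex of the chain
    counted among them.\<close>
  define zs where "zs = take k (p *\<^sub>R e # xs)"
  have len: "length zs = k" using \<open>k \<le> length xs\<close> by (simp add: zs_def)
  have zsub: "set zs \<subseteq> set (p *\<^sub>R e # xs)" unfolding zs_def by (rule set_take_subset)
  have "distinct zs" unfolding zs_def using xs(2) by (rule distinct_take)
  have zS: "set zs \<subseteq> S" using zsub xs(3) pS by auto
  have near: "dist (g x) (g y) \<le> dist x y + 2 * h" for x y
    using G(3)[of x] G(3)[of y] dist_triangle[of "g x" "g y" x] dist_triangle[of x "g y" y]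
    by (simp add: dist_commute)
  have away: "dist x y \<le> dist (g x) (g y) + 2 * h" for x y
    using G(3)[of x] G(3)[of y] dist_triangle[of x y "g x"] dist_triangle[of "g x" y "g y"]
    by (simp add: dist_commute)
  \<comment> \<open>Rounding costs \<open>2 * h\<close> in each distance, which is the surplus of
    \<open>D\<close> over \<open>2 * \<rho>\<close>.\<close>
  have sepg: "dist (g x) (g y) \<ge> 2 * \<rho>" if "x \<in> set zs" "y \<in> set zs" "x \<noteq> y" for x y
  proof -
    have "D \<le> dist x y" using that zsub by (intro sep) auto
    then show ?thesis using away[of x y] D by linarith
  qed
  \<comment> \<open>The added step from \<open>v\<close> to the first vertex has length at most
    \<open>4 * D\<close> because \<open>p\<close> lies between \<open>4 * D * k\<close> and
    \<open>4 * D * (k + 1)\<close>.\<close>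
  have step: "dist ((v # zs) ! i) (zs ! i) \<le> 4 * D" if "i < k" for i
  proof (cases i)
    case 0
    have "p *\<^sub>R e - v = (p - 4 * D * real k) *\<^sub>R e" by (simp add: v_def algebra_simps)
    then have "dist v (p *\<^sub>R e) = \<bar>p - 4 * D * real k\<bar>"
      using e by (metis dist_commute dist_norm mult.right_neutral norm_scaleR)
    also have "\<dots> \<le> 4 * D" using k by (simp add: algebra_simps)
    finally show ?thesis using 0 that by (simp add: zs_def)
  next
    case (Suc j)
    then show ?thesis
      using rtrancl_path_nth[OF xs(1), of j] that \<open>k \<le> length xs\<close> by (simp add: zs_def)
  qed
  show ?thesis
  proof
    show "map g zs \<in> lattice_paths (G \<inter> cball 0 (4 * D + 2 * h)) k (g ((4 * D * real k) *\<^sub>R e))"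
      unfolding lattice_paths_def v_def[symmetric]
    proof (intro CollectI conjI allI impI)
      fix i assume i: "i < k"
      have eq: "(g v # map g zs) ! i = g ((v # zs) ! i)"
        using i len by (metis length_Cons less_SucI list.map(2) nth_map)
      have "norm (g (zs ! i) - g ((v # zs) ! i)) \<le> 4 * D + 2 * h"
        using near[of "(v # zs) ! i" "zs ! i"] step[OF i] by (simp add: dist_norm norm_minus_commute)
      then show "map g zs ! i - (g v # map g zs) ! i \<in> G \<inter> cball 0 (4 * D + 2 * h)"
        unfolding eq using i len G(1,2) by simp
    qed (simp add: len)
    \<comment> \<open>Rounding merges no vertices, so there really are \<open>k\<close> different
      balls.\<close>
    have "inj_on g (set zs)"
    proof (rule inj_onI, rule ccontr)
      fix x y assume "x \<in> set zs" "y \<in> set zs" "g x = g y" "x \<noteq> y"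
      then show False using sepg[of x y] \<open>\<rho> > 0\<close> by simp
    qed
    then show "distinct (map g zs)" using \<open>distinct zs\<close> by (simp add: distinct_map)
    show "dist x y \<ge> 2 * \<rho>" if "x \<in> set (map g zs)" "y \<in> set (map g zs)" "x \<noteq> y" for x y
      using that sepg by auto
    show "\<exists>x\<in>S. dist y x \<le> h" if "y \<in> set (map g zs)" for y
      using that zS G(3) by auto
  qed
qed

section \<open>The infinite cluster\<close>

theorem theorem3p1:
  fixes lt :: "'a::euclidean_space \<Rightarrow> 'a set \<Rightarrow> real" and r \<delta> :: real
  assumes "DIM('a) \<ge> 2"
    and "normalized_cond_intensity lt"
    and "r > 0" and "\<delta> > 0"
    and "cond_P r \<delta> lt"
  shows "\<forall>R>r. \<exists>\<beta>_plus::real. \<forall>\<beta>>\<beta>_plus. \<forall>\<mu>\<in>gibbs_measures \<beta> lt.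
           AE \<xi> in \<mu>. has_infinite_cluster (Z R \<xi>)"
proof (intro allI impI)
  fix R assume "R > r"
  define h where "h = (R - r) / 2"
  \<comment> \<open>\<open>\<rho> + h = R\<close> pays for rounding a point off
    \<open>Z R \<xi>\<close>, and \<open>\<rho> = r + h\<close> leaves a gap of \<open>r\<close>
    around each point of the inner \<open>h\<close>-ball.\<close>
  define \<rho> where "\<rho> = r + h"
  define D where "D = 2 * \<rho> + 2 * h"
  define m where "m = measure lborel (ball (0::'a) h)"
  have "h > 0" using \<open>R > r\<close> by (simp add: h_def)
  have "\<rho> > 0" using \<open>h > 0\<close> \<open>r > 0\<close> by (simp add: \<rho>_def)
  have "D > 0" using \<open>h > 0\<close> \<open>\<rho> > 0\<close> by (simp add: D_def)
  have "m > 0" using content_ball_pos[OF \<open>h > 0\<close>, of "0::'a"] by (simp add: m_def)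
  obtain G :: "'a set" and g where G: "\<And>x y. x \<in> G \<Longrightarrow> y \<in> G \<Longrightarrow> x - y \<in> G"
      "\<And>x. g x \<in> G" "\<And>x. dist (g x) x \<le> h" and Gfin: "\<And>B. bounded B \<Longrightarrow> finite (G \<inter> B)"
    using lattice_rounding[OF \<open>h > 0\<close>] by metis
  define N where "N = G \<inter> cball 0 (4 * D + 2 * h)"
  have "finite N" unfolding N_def by (rule Gfin) simp
  obtain e :: 'a where e: "norm e = 1" using vector_choose_size[of 1] by auto
  define v where "v k = g ((4 * D * real k) *\<^sub>R e)" for k
  define paths where "paths k = {ys \<in> lattice_paths N k (v k). distinct ys \<and>
    (\<forall>x\<in>set ys. \<forall>y\<in>set ys. x \<noteq> y \<longrightarrow> dist x y \<ge> 2 * \<rho>)}" for k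
  have fin_paths: "finite (paths k)" and card_paths: "card (paths k) \<le> card N ^ k" for k
  proof -
    have *: "paths k \<subseteq> lattice_paths N k (v k)" by (auto simp: paths_def)
    show "finite (paths k)"
      using * finite_card_lattice_paths[OF \<open>finite N\<close>] by (rule finite_subset[OF _ conjunct1])
    show "card (paths k) \<le> card N ^ k"
      using card_mono[OF _ *] finite_card_lattice_paths[OF \<open>finite N\<close>, of k "v k"] by auto
  qed
  define vacant where "vacant ys = {\<xi> \<in> configs. \<forall>y\<in>set ys. \<xi> \<inter> ball y \<rho> = {}}" for ys :: "'a list"
  define E where "E k = (\<Union>ys\<in>paths k. vacant ys)" for k
  \<comment> \<open>Bounded clusters put \<open>\<xi>\<close> into infinitely many of the events
    \<open>E k\<close>.\<close>
  have deterministic: "\<exists>k\<ge>n. \<xi> \<in> E k" if \<xi>: "\<xi> \<in> configs" "\<not> has_infinite_cluster (Z R \<xi>)" for \<xi> n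
  proof -
    have "4 * D * real (Suc n) > 0" using \<open>D > 0\<close> by simp
    then obtain S p q where S: "compact S" "connected S" "S \<inter> Z R \<xi> = {}"
      "p *\<^sub>R e \<in> S" "- (q *\<^sub>R e) \<in> S" "p \<ge> 4 * D * real (Suc n)" "q \<ge> 0"
      using surrounding_set[OF assms(1) \<xi>(1) _ e \<xi>(2)] by metis
    \<comment> \<open>The unknown distance \<open>p\<close> is put into a bin of width
      \<open>4 * D\<close>, so that the start of the path depends on \<open>k\<close> alone.\<close>
    define k where "k = nat \<lfloor>p / (4 * D)\<rfloor>"
    have "real (Suc n) \<le> p / (4 * D)" using S(6) \<open>D > 0\<close> by (simp add: field_simps)
    then have "k \<ge> n" "real k \<le> p / (4 * D)" "p / (4 * D) \<le> real (Suc k)"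
      unfolding k_def by linarith+
    then have k: "k \<ge> n" "4 * D * real k \<le> p" "p \<le> 4 * D * real (Suc k)"
      using \<open>D > 0\<close> by (simp_all add: field_simps)
    obtain ys where ys: "ys \<in> lattice_paths N k (v k)" "distinct ys"
      "\<And>x y. x \<in> set ys \<Longrightarrow> y \<in> set ys \<Longrightarrow> x \<noteq> y \<Longrightarrow> dist x y \<ge> 2 * \<rho>"
      "\<And>y. y \<in> set ys \<Longrightarrow> \<exists>x\<in>S. dist y x \<le> h"
      using vacant_lattice_path[OF S(1,2,4,5) e S(7) \<open>\<rho> > 0\<close> \<open>h > 0\<close> D_def k(2,3) G]
      unfolding N_def v_def by metis
    have "\<xi> \<inter> ball y \<rho> = {}" if y: "y \<in> set ys" for y
    proof -
      obtain x where x: "x \<in> S" "dist y x \<le> h" using ys(4)[OF y] by blast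
      have False if "z \<in> \<xi>" "dist y z < \<rho>" for z
      proof -
        have "dist z x < R"
          using that(2) x(2) dist_triangle3[of z x y] by (simp add: \<rho>_def h_def field_simps)
        then have "x \<in> Z R \<xi>" using that(1) by (auto simp: Z_def)
        then show False using S(3) x(1) by auto
      qed
      then show ?thesis by auto
    qed
    then have "\<xi> \<in> E k"
      using ys \<xi>(1) unfolding E_def paths_def vacant_def by blast
    then show ?thesis using k(1) by blast
  qed
  \<comment> \<open>Chosen so that \<open>card N * \<epsilon> \<le> 1 / 2\<close> below; the
    \<open>+ 1\<close> makes \<open>B\<close> positive whatever \<open>card N\<close> is, so that
    \<open>\<beta> > B\<close> gives \<open>\<beta> > 0\<close>.\<close>
  define B where "B = 2 * (real (card N) + 1) / (\<delta> * m)"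
  have "B > 0" using \<open>\<delta> > 0\<close> \<open>m > 0\<close> by (simp add: B_def)
  show "\<exists>\<beta>_plus::real. \<forall>\<beta>>\<beta>_plus. \<forall>\<mu>\<in>gibbs_measures \<beta> lt. AE \<xi> in \<mu>. has_infinite_cluster (Z R \<xi>)"
  proof (intro exI[of _ B] allI impI ballI)
    fix \<beta> \<mu> assume "\<beta> > B" and mu: "\<mu> \<in> gibbs_measures \<beta> lt"
    have "\<beta> > 0" using \<open>\<beta> > B\<close> \<open>B > 0\<close> by simp
    obtain \<Phi> where \<Phi>: "potential \<Phi>" "has_cond_intensity \<Phi> (\<lambda>x \<xi>. \<beta> * lt x \<xi>)" "gibbs_measure \<Phi> \<mu>"
      using mu by (auto simp: gibbs_measures_def)
    have sets: "sets \<mu> = sets config_algebra" using \<Phi>(3) by (simp add: gibbs_measure_def)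
    have sp: "space \<mu> = configs" using sets_eq_imp_space_eq[OF sets] by simp
    interpret mu: prob_space \<mu> using \<Phi>(3) by (simp add: gibbs_measure_def)
    have P: "AE \<xi> in \<mu>. point_dist y \<xi> \<ge> ereal r \<longrightarrow> \<beta> * lt y \<xi> \<ge> \<beta> * \<delta>" for y
    proof -
      have "AE \<xi> in \<mu>. point_dist y \<xi> \<ge> ereal r \<longrightarrow> lt y \<xi> \<ge> \<delta>"
        using assms(5) mu \<open>\<beta> > 0\<close> unfolding cond_P_def measure_cond_P_def by blast
      then show ?thesis using \<open>\<beta> > 0\<close> by (rule_tac AE_mp) (auto intro!: AE_I2)
    qed
    define \<epsilon> where "\<epsilon> = 1 / (\<beta> * \<delta> * m)"
    have "\<epsilon> > 0" using \<open>\<beta> > 0\<close> \<open>\<delta> > 0\<close> \<open>m > 0\<close> by (simp add: \<epsilon>_def)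
    have small: "card N * \<epsilon> \<le> 1 / 2"
    proof -
      have "2 * (real (card N) + 1) < \<beta> * (\<delta> * m)"
        using \<open>\<beta> > B\<close> \<open>\<delta> > 0\<close> \<open>m > 0\<close> unfolding B_def by (simp add: pos_divide_less_eq)
      then show ?thesis
        using \<open>\<beta> > 0\<close> \<open>\<delta> > 0\<close> \<open>m > 0\<close> by (simp add: \<epsilon>_def pos_divide_le_eq mult.assoc)
    qed
    have vacant_sets: "vacant ys \<in> sets \<mu>" for ys
      unfolding vacant_def sets by (rule void_events_sets) simp
    have E_sets: "E k \<in> sets \<mu>" for k
      unfolding E_def using fin_paths vacant_sets by blast
    have vacant_bound: "measure \<mu> (vacant ys) \<le> \<epsilon> ^ k" if "ys \<in> paths k" for ys k
    proof -
      have "measure \<mu> (vacant ys) \<le> (1 / (\<beta> * \<delta> * m)) ^ card (set ys)"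
        unfolding vacant_def \<rho>_def m_def
        by (rule void_events_bound[OF \<Phi>(1,3,2) P])
          (use that \<open>r > 0\<close> \<open>\<beta> > 0\<close> \<open>\<delta> > 0\<close> \<open>m > 0\<close> in \<open>auto simp: paths_def \<rho>_def m_def\<close>)
      also have "card (set ys) = k"
        using that by (simp add: paths_def lattice_paths_def distinct_card)
      finally show ?thesis by (simp add: \<epsilon>_def)
    qed
    \<comment> \<open>Union bound: at most \<open>card N ^ k\<close> paths, each vacant with
      probability at most \<open>\<epsilon> ^ k\<close>.\<close>
    have E_bound: "measure \<mu> (E k) \<le> (1 / 2) ^ k" for k
    proof -
      have "measure \<mu> (E k) \<le> (\<Sum>ys\<in>paths k. measure \<mu> (vacant ys))"
        unfolding E_def using fin_paths vacant_sets by (intro mu.finite_measure_subadditive_finite) auto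
      also have "\<dots> \<le> card (paths k) * \<epsilon> ^ k"
        using vacant_bound by (intro sum_bounded_above)
      also have "\<dots> \<le> real (card N ^ k) * \<epsilon> ^ k"
        using card_paths[of k] \<open>\<epsilon> > 0\<close> by (intro mult_right_mono of_nat_mono) auto
      also have "\<dots> = (card N * \<epsilon>) ^ k" by (simp add: power_mult_distrib)
      also have "\<dots> \<le> (1 / 2) ^ k" using small \<open>\<epsilon> > 0\<close> by (intro power_mono) auto
      finally show ?thesis .
    qed
    have "summable (\<lambda>k. measure \<mu> (E k))"
      by (rule summable_comparison_test'[OF summable_geometric[of "1 / 2 :: real"]])
        (use E_bound in auto)
    \<comment> \<open>Borel-Cantelli: almost surely only finitely many \<open>E k\<close> occur,
      which contradicts \<open>deterministic\<close> unless there is an infinite cluster.\<close>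
    then have "AE \<xi> in \<mu>. eventually (\<lambda>k. \<xi> \<in> space \<mu> - E k) sequentially"
      by (intro borel_cantelli_AE1 E_sets) (simp_all add: mu.emeasure_eq_measure)
    then show "AE \<xi> in \<mu>. has_infinite_cluster (Z R \<xi>)"
    proof (rule AE_mp, intro AE_I2 impI)
      fix \<xi> assume "\<xi> \<in> space \<mu>" "eventually (\<lambda>k. \<xi> \<in> space \<mu> - E k) sequentially"
      then show "has_infinite_cluster (Z R \<xi>)"
        using deterministic[of \<xi>] unfolding eventually_sequentially sp by blast
    qed
  qed
qed

end
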